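(* Let $m\ge 2$. For all $n_1,\ldots,n_m\in\mathbb{N}_{\ge1}$ consider $$\pi_1(n_1,\ldots,n_m)=\mathbb{P}(A_2\le n_2-1,\ldots,A_m\le n_m-1),$$ where $(A_2,\ldots,A_m)$ has a negative multinomial distribution with parameters $(n_1;p_2,\ldots,p_m)$, where $p_\ell=\frac{n_\ell}{n_1+\cdots+n_m}$ for $\ell\in\{2,\ldots,m\}$. Then the following representations hold: (1) $\pi_1(n_1,\ldots,n_m)=\mathbb{P}\left(X_2>\frac{n_2}{n_1},\ldots,X_m>\frac{n_m}{n_1}\right)$, where $(X_2,\ldots,X_m)\sim\operatorname{ID}(n_2,\ldots,n_m;n_1)$. (2) $\pi_1(n_1,\ldots,n_m)=\mathbb{P}\left(\frac{G_2}{n_2}>\frac{G_1}{n_1},\ldots,\frac{G_m}{n_m}>\frac{G_1}{n_1}\right)$, where $G_1,\ldots,G_m$ are independent random variables with $G_j\sim\operatorname{Gamma}(n_j,1)$, $j=1,\ldots,m$.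
   Context: Negative multinomial distribution with parameters $(n_1;p_2,\ldots,p_m)$, with $p_1:=1-\sum_{k=2}^m p_k>0$: for all integers $k_2,\ldots,k_m\ge0$, $$\mathbb{P}(A_2=k_2,\ldots,A_m=k_m)=\frac{(n_1+k_2+\cdots+k_m-1)!}{(n_1-1)!\,k_2!\cdots k_m!}\,p_1^{n_1}\prod_{\ell=2}^m p_\ell^{k_\ell}.$$ Inverted Dirichlet distribution $\operatorname{ID}(n_2,\ldots,n_m;n_1)$: the distribution on $[0,\infty)^{m-1}$ with density $$(s_2,\ldots,s_m)\mapsto\frac{\Gamma\big(\sum_{k=1}^m n_k\big)}{\prod_{k=1}^m\Gamma(n_k)}\cdot\frac{\prod_{k=2}^m s_k^{n_k-1}}{\big(1+\sum_{k=2}^m s_k\big)^{\sum_{k=1}^m n_k}}.$$ $\operatorname{Gamma}(a,1)$ is the distribution on $(0,\infty)$ with density $x^{a-1}e^{-x}/\Gamma(a)$. *)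

theory Defs
  imports "HOL-Probability.Probability"
begin

text \<open>
  Random vectors indexed by \<open>2, \<dots>, m\<close> are families \<open>A :: nat \<Rightarrow> 'a \<Rightarrow> _\<close> of which only
  the components with index in \<open>{2..m}\<close> are relevant. Likewise for parameters and points.
\<close>

text \<open>Here \<open>p\<^sub>1 = 1 - (\<Sum>l=2..m. p l)\<close>. The subtraction of 1 on \<open>nat\<close> is used for \<open>r \<ge> 1\<close> only.\<close>

definition neg_multinomial_mass ::
  "nat \<Rightarrow> nat \<Rightarrow> (nat \<Rightarrow> real) \<Rightarrow> (nat \<Rightarrow> nat) \<Rightarrow> real" where
  "neg_multinomial_mass m r p k =
     fact (r + (\<Sum>l=2..m. k l) - 1) / (fact (r - 1) * (\<Prod>l=2..m. fact (k l)))
       * (1 - (\<Sum>l=2..m. p l)) ^ r * (\<Prod>l=2..m. p l ^ k l)"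

definition neg_multinomial_distributed ::
  "'a measure \<Rightarrow> (nat \<Rightarrow> 'a \<Rightarrow> nat) \<Rightarrow> nat \<Rightarrow> nat \<Rightarrow> (nat \<Rightarrow> real) \<Rightarrow> bool" where
  "neg_multinomial_distributed M A m r p \<longleftrightarrow>
     1 - (\<Sum>l=2..m. p l) > 0 \<and>
     (\<forall>l\<in>{2..m}. A l \<in> measurable M (count_space UNIV)) \<and>
     (\<forall>k. \<P>(\<omega> in M. \<forall>l\<in>{2..m}. A l \<omega> = k l) = neg_multinomial_mass m r p k)"

text \<open>The density of \<open>ID(n 2, \<dots>, n m; n 1)\<close>, extended by 0 outside of the nonnegative orthant.\<close>

definition inv_dirichlet_density ::
  "nat \<Rightarrow> (nat \<Rightarrow> nat) \<Rightarrow> (nat \<Rightarrow> real) \<Rightarrow> real" where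
  "inv_dirichlet_density m n s =
     (if \<forall>k\<in>{2..m}. s k \<ge> 0 then
        Gamma (\<Sum>k=1..m. real (n k)) / (\<Prod>k=1..m. Gamma (real (n k)))
          * ((\<Prod>k=2..m. s k ^ (n k - 1)) / (1 + (\<Sum>k=2..m. s k)) ^ (\<Sum>k=1..m. n k))
      else 0)"

definition inv_dirichlet_distributed ::
  "'a measure \<Rightarrow> (nat \<Rightarrow> 'a \<Rightarrow> real) \<Rightarrow> nat \<Rightarrow> (nat \<Rightarrow> nat) \<Rightarrow> bool" where
  "inv_dirichlet_distributed M X m n \<longleftrightarrow>
     distributed M (PiM {2..m} (\<lambda>_. lborel)) (\<lambda>\<omega>. \<lambda>k\<in>{2..m}. X k \<omega>)
       (\<lambda>s. ennreal (inv_dirichlet_density m n s))"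

definition gamma_density :: "real \<Rightarrow> real \<Rightarrow> real" where
  "gamma_density a x = (if x > 0 then x powr (a - 1) * exp (- x) / Gamma a else 0)"

end

theory Submission imports Defs begin

text \<open>
  Write \<open>c\<^sub>l = n\<^sub>l / n\<^sub>1\<close> and let \<open>F k\<close> be the tail of the Erlang distribution with shape \<open>k + 1\<close> and
  rate 1, which is the Poisson sum \<open>F k y = (\<Sum>i\<le>k. y^i / i! * exp (- y))\<close>. All three probabilities are
  equal to \<open>\<integral> erlang(n\<^sub>1)(x) * (\<Prod>l. F (n\<^sub>l - 1) (c\<^sub>l * x)) dx\<close>. For the negative multinomial law, expand
  the product of Poisson sums and integrate term by term. For independent gamma variables, condition
  on \<open>G\<^sub>1 = x\<close>. For the inverted Dirichlet law, write \<open>\<Gamma>(N) / (1 + S)^N\<close> as the integral of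
  \<open>x^(N - 1) * exp (- x * (1 + S))\<close>: given \<open>x\<close>, the coordinates become independent Erlang variables
  with rate \<open>x\<close>.
\<close>

section \<open>Erlang tails as Poisson sums\<close>

definition poisson_cdf :: "nat \<Rightarrow> real \<Rightarrow> real" where
  "poisson_cdf k y = (\<Sum>i\<le>k. y ^ i / fact i * exp (- y))"

lemma poisson_cdf_nonneg: "0 \<le> y \<Longrightarrow> 0 \<le> poisson_cdf k y"
  by (auto simp: poisson_cdf_def intro!: sum_nonneg)

lemma nn_integral_erlang_density_UNIV:
  assumes "0 < l"
  shows "(\<integral>\<^sup>+x. ennreal (erlang_density k l x) \<partial>lborel) = 1"
  using nn_integral_erlang_ith_moment[OF assms, of k 0] by simp

text \<open>The Erlang distribution function is 1 minus a Poisson sum, so the complement is the sum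
  itself. Rate and threshold enter only through their product: a rate \<open>x\<close> with
  threshold \<open>c l\<close> gives the same value as rate 1 with threshold \<open>c l * x\<close>,
  which is why the inverted Dirichlet and the gamma computations meet in one integral.\<close>

lemma nn_integral_erlang_density_greaterThan:
  assumes "0 < l" "0 \<le> c"
  shows "(\<integral>\<^sup>+y. ennreal (erlang_density k l y) * indicator {c<..} y \<partial>lborel)
    = ennreal (poisson_cdf k (l * c))"
proof -
  interpret D: prob_space "density lborel (erlang_density k l)"
    using assms by (intro prob_space_erlang_density) auto
  have "measure (density lborel (erlang_density k l)) {c<..}
      = 1 - measure (density lborel (erlang_density k l)) {..c}"
    by (subst D.prob_compl[symmetric]) (auto intro!: arg_cong2[where f = measure])
  also have "\<dots> = 1 - erlang_CDF k l c"
    using assms by (simp add: measure_def emeasure_erlang_density)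
  also have "\<dots> = poisson_cdf k (l * c)"
    using assms by (simp add: erlang_CDF_def poisson_cdf_def)
  finally have "emeasure (density lborel (erlang_density k l)) {c<..} = ennreal (poisson_cdf k (l * c))"
    by (simp add: D.emeasure_eq_measure)
  then show ?thesis
    by (simp add: emeasure_density)
qed

section \<open>Negative multinomial law\<close>

text \<open>Multiplying out the Poisson sums leaves, for each choice of exponents \<open>k\<close>,
  a monomial in \<open>x\<close> times \<open>exp (- q * x)\<close>, hence a multiple of an Erlang
  density with rate \<open>q\<close>. The multiple is the negative multinomial mass at
  \<open>k\<close> with first parameter \<open>r + 1\<close> and probabilities
  \<open>c l / q\<close>, the leftover probability being \<open>1 / q\<close>. The first parameter
  is shifted because \<open>erlang_density r\<close> has shape \<open>r + 1\<close>.\<close>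

lemma erlang_density_prod_poisson_cdf:
  fixes c :: "'i \<Rightarrow> real" and K :: "'i \<Rightarrow> nat"
  assumes L: "finite L" and c: "\<And>l. l \<in> L \<Longrightarrow> 0 \<le> c l" and x: "0 \<le> x"
  defines "q \<equiv> 1 + (\<Sum>l\<in>L. c l)"
  shows "erlang_density r 1 x * (\<Prod>l\<in>L. poisson_cdf (K l) (c l * x))
    = (\<Sum>k\<in>(\<Pi>\<^sub>E l\<in>L. {..K l}).
        fact (r + (\<Sum>l\<in>L. k l)) / (fact r * (\<Prod>l\<in>L. fact (k l))) * (1 / q) ^ Suc r
          * (\<Prod>l\<in>L. (c l / q) ^ k l) * erlang_density (r + (\<Sum>l\<in>L. k l)) q x)"
proof -
  have q: "q > 0"
    using c by (auto simp: q_def intro!: add_pos_nonneg sum_nonneg)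
  have "erlang_density r 1 x * (\<Prod>l\<in>L. poisson_cdf (K l) (c l * x))
    = (\<Sum>k\<in>(\<Pi>\<^sub>E l\<in>L. {..K l}). erlang_density r 1 x *
        (\<Prod>l\<in>L. (c l * x) ^ k l / fact (k l) * exp (- (c l * x))))"
    using L by (simp add: poisson_cdf_def prod_sum_PiE sum_distrib_left)
  also have "\<dots> = (\<Sum>k\<in>(\<Pi>\<^sub>E l\<in>L. {..K l}).
        fact (r + (\<Sum>l\<in>L. k l)) / (fact r * (\<Prod>l\<in>L. fact (k l))) * (1 / q) ^ Suc r
          * (\<Prod>l\<in>L. (c l / q) ^ k l) * erlang_density (r + (\<Sum>l\<in>L. k l)) q x)"
  proof (rule sum.cong)
    fix k :: "'i \<Rightarrow> nat"
    have "erlang_density r 1 x * (\<Prod>l\<in>L. (c l * x) ^ k l / fact (k l) * exp (- (c l * x)))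
        = erlang_density r 1 x * ((\<Prod>l\<in>L. c l ^ k l) * x ^ (\<Sum>l\<in>L. k l) / (\<Prod>l\<in>L. fact (k l)) * exp (- (\<Sum>l\<in>L. c l) * x))"
      using L by (simp add: prod.distrib prod_dividef power_mult_distrib power_sum sum_distrib_right
          sum_negf flip: exp_sum)
    also have "\<dots> = x ^ r * x ^ (\<Sum>l\<in>L. k l) * (exp (- x) * exp (- (\<Sum>l\<in>L. c l) * x))
        * (\<Prod>l\<in>L. c l ^ k l) / (fact r * (\<Prod>l\<in>L. fact (k l)))"
      using x by (simp add: erlang_density_def)
    also have "exp (- x) * exp (- (\<Sum>l\<in>L. c l) * x) = exp (- q * x)"
      by (simp add: q_def algebra_simps flip: exp_add)
    \<comment> \<open>Passing from \<open>c l\<close> to the probability \<open>c l / q\<close>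
      releases one factor \<open>q\<close> per unit of \<open>k l\<close>. The other
      \<open>r + 1\<close> factors of \<open>q\<close> contained in the target Erlang density are
      cancelled by \<open>(1 / q) ^ Suc r\<close>.\<close>
    also have "(\<Prod>l\<in>L. c l ^ k l) = q ^ (\<Sum>l\<in>L. k l) * (\<Prod>l\<in>L. (c l / q) ^ k l)"
      using q by (simp add: prod_dividef power_divide flip: power_sum)
    also have "x ^ r * x ^ (\<Sum>l\<in>L. k l) * exp (- q * x)
        * (q ^ (\<Sum>l\<in>L. k l) * (\<Prod>l\<in>L. (c l / q) ^ k l)) / (fact r * (\<Prod>l\<in>L. fact (k l)))
      = fact (r + (\<Sum>l\<in>L. k l)) / (fact r * (\<Prod>l\<in>L. fact (k l))) * (1 / q) ^ Suc r
          * (\<Prod>l\<in>L. (c l / q) ^ k l) * erlang_density (r + (\<Sum>l\<in>L. k l)) q x"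
      using x q by (simp add: erlang_density_def power_add power_one_over divide_simps)
    finally show "erlang_density r 1 x *
        (\<Prod>l\<in>L. (c l * x) ^ k l / fact (k l) * exp (- (c l * x)))
      = fact (r + (\<Sum>l\<in>L. k l)) / (fact r * (\<Prod>l\<in>L. fact (k l))) * (1 / q) ^ Suc r
          * (\<Prod>l\<in>L. (c l / q) ^ k l) * erlang_density (r + (\<Sum>l\<in>L. k l)) q x" .
  qed simp
  finally show ?thesis .
qed

text \<open>Each Erlang density in the pointwise expansion integrates to 1, so only the weights
  survive.\<close>

lemma nn_integral_erlang_prod_poisson_cdf:
  fixes c :: "'i \<Rightarrow> real" and K :: "'i \<Rightarrow> nat"
  assumes L: "finite L" and c: "\<And>l. l \<in> L \<Longrightarrow> 0 \<le> c l"
  defines "q \<equiv> 1 + (\<Sum>l\<in>L. c l)"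
  shows "(\<integral>\<^sup>+x. ennreal (erlang_density r 1 x)
        * (\<Prod>l\<in>L. ennreal (poisson_cdf (K l) (c l * x))) \<partial>lborel)
    = ennreal (\<Sum>k\<in>(\<Pi>\<^sub>E l\<in>L. {..K l}).
        fact (r + (\<Sum>l\<in>L. k l)) / (fact r * (\<Prod>l\<in>L. fact (k l))) * (1 / q) ^ Suc r
          * (\<Prod>l\<in>L. (c l / q) ^ k l))"
proof -
  have q: "q > 0"
    using c by (auto simp: q_def intro!: add_pos_nonneg sum_nonneg)
  define w where "w k = fact (r + (\<Sum>l\<in>L. k l)) / (fact r * (\<Prod>l\<in>L. fact (k l))) * (1 / q) ^ Suc r
          * (\<Prod>l\<in>L. (c l / q) ^ k l)" for k :: "'i \<Rightarrow> nat"
  have w: "0 \<le> w k" for k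
    using q c unfolding w_def by (intro mult_nonneg_nonneg divide_nonneg_nonneg prod_nonneg) auto
  have "ennreal (erlang_density r 1 x) * (\<Prod>l\<in>L. ennreal (poisson_cdf (K l) (c l * x)))
      = (\<Sum>k\<in>(\<Pi>\<^sub>E l\<in>L. {..K l}). ennreal (w k) * ennreal (erlang_density (r + (\<Sum>l\<in>L. k l)) q x))" for x
  \<comment> \<open>The expansion is available for nonnegative \<open>x\<close> only; for negative
    \<open>x\<close> all Erlang densities vanish and both sides are 0.\<close>
  proof (cases "0 \<le> x")
    case True
    have "ennreal (erlang_density r 1 x) * (\<Prod>l\<in>L. ennreal (poisson_cdf (K l) (c l * x)))
      = ennreal (erlang_density r 1 x * (\<Prod>l\<in>L. poisson_cdf (K l) (c l * x)))"
      using True c by (simp add: prod_ennreal poisson_cdf_nonneg ennreal_mult prod_nonneg)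
    also have "\<dots> = ennreal (\<Sum>k\<in>(\<Pi>\<^sub>E l\<in>L. {..K l}). w k * erlang_density (r + (\<Sum>l\<in>L. k l)) q x)"
      using erlang_density_prod_poisson_cdf[OF L c True, where r = r and K = K] by (simp add: w_def q_def)
    also have "\<dots> = (\<Sum>k\<in>(\<Pi>\<^sub>E l\<in>L. {..K l}). ennreal (w k) * ennreal (erlang_density (r + (\<Sum>l\<in>L. k l)) q x))"
      using w q by (simp add: ennreal_mult flip: sum_ennreal)
    finally show ?thesis .
  qed (simp add: erlang_density_def)
  then have "(\<integral>\<^sup>+x. ennreal (erlang_density r 1 x)
        * (\<Prod>l\<in>L. ennreal (poisson_cdf (K l) (c l * x))) \<partial>lborel)
    = (\<Sum>k\<in>(\<Pi>\<^sub>E l\<in>L. {..K l}). ennreal (w k))"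
    using q by (simp add: nn_integral_sum nn_integral_cmult nn_integral_erlang_density_UNIV)
  then show ?thesis
    using w by (simp add: w_def)
qed

lemma neg_multinomial_prob_atMost:
  assumes "prob_space M" and nm: "neg_multinomial_distributed M A m r p"
  shows "\<P>(\<omega> in M. \<forall>l\<in>{2..m}. A l \<omega> \<le> K l)
    = (\<Sum>k\<in>(\<Pi>\<^sub>E l\<in>{2..m}. {..K l}). neg_multinomial_mass m r p k)"
proof -
  interpret prob_space M by fact
  have meas[measurable]: "\<And>l. l \<in> {2..m} \<Longrightarrow> A l \<in> measurable M (count_space UNIV)"
    and mass: "\<And>k. \<P>(\<omega> in M. \<forall>l\<in>{2..m}. A l \<omega> = k l) = neg_multinomial_mass m r p k"
    using nm by (auto simp: neg_multinomial_distributed_def)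
  let ?E = "\<lambda>k. {\<omega>\<in>space M. \<forall>l\<in>{2..m}. A l \<omega> = k l}"
  have "{\<omega>\<in>space M. \<forall>l\<in>{2..m}. A l \<omega> \<le> K l} = (\<Union>k\<in>(\<Pi>\<^sub>E l\<in>{2..m}. {..K l}). ?E k)" (is "?L = ?R")
  proof
    show "?L \<subseteq> ?R"
    proof
      fix \<omega> assume "\<omega> \<in> ?L"
      then show "\<omega> \<in> ?R"
        by (intro UN_I[of "\<lambda>l\<in>{2..m}. A l \<omega>"]) auto
    qed
  qed (auto simp: PiE_iff)
  moreover have "disjoint_family_on ?E (\<Pi>\<^sub>E l\<in>{2..m}. {..K l})"
    unfolding disjoint_family_on_def
  proof (intro ballI impI)
    \<comment> \<open>Members of the extensional product agree off \<open>{2..m}\<close>, so two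
      distinct ones differ at an index that the point events constrain.\<close>
    fix k k' assume k: "k \<in> (\<Pi>\<^sub>E l\<in>{2..m}. {..K l})" "k' \<in> (\<Pi>\<^sub>E l\<in>{2..m}. {..K l})" "k \<noteq> k'"
    then obtain l where "l \<in> {2..m}" "k l \<noteq> k' l"
      using PiE_ext[OF k(1,2)] by metis
    then show "?E k \<inter> ?E k' = {}"
      by force
  qed
  moreover have "?E k \<in> sets M" for k
    by measurable
  ultimately show ?thesis
    by (simp add: finite_measure_finite_Union finite_PiE image_subset_iff mass)
qed

section \<open>Inverted Dirichlet law\<close>

text \<open>For fixed \<open>s\<close> the integrand, as a function of \<open>x\<close>, is the
  inverted Dirichlet density at \<open>s\<close> times an Erlang density of shape \<open>N\<close>
  and rate \<open>q\<close>, and the latter integrates to 1. This is the density of independent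
  gamma variables divided by a common one: given that the divisor equals \<open>x\<close>, the
  quotients are independent Erlang variables with rate \<open>x\<close>.\<close>

lemma inv_dirichlet_density_mixture:
  assumes m: "2 \<le> m" and n: "\<And>j. j \<in> {1..m} \<Longrightarrow> 1 \<le> n j" and s: "\<And>k. k \<in> {2..m} \<Longrightarrow> 0 \<le> s k"
  shows "ennreal (inv_dirichlet_density m n s)
    = (\<integral>\<^sup>+x. ennreal (erlang_density (n 1 - 1) 1 x)
        * (\<Prod>k\<in>{2..m}. ennreal (erlang_density (n k - 1) x (s k))) \<partial>lborel)"
proof -
  define q where "q = 1 + (\<Sum>k=2..m. s k)"
  define N where "N = (\<Sum>k=1..m. n k)"
  have q: "0 < q"
    using s by (auto simp: q_def intro!: add_pos_nonneg sum_nonneg)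
  have split: "{1..m} = insert 1 {2..m}"
    using m by auto
  have N_eq: "N = n 1 + (\<Sum>k=2..m. n k)"
    unfolding N_def split by simp
  have n1: "1 \<le> n 1" and n2: "\<And>k. k \<in> {2..m} \<Longrightarrow> 1 \<le> n k"
    using n m by auto
  then have "1 \<le> N"
    by (simp add: N_eq)
  have Gamma_nat: "Gamma (real j) = fact (j - 1)" if "1 \<le> j" for j
    using that by (cases j) (auto simp: Gamma_fact[symmetric] add_ac)
  have dens: "inv_dirichlet_density m n s
      = fact (N - 1) / (fact (n 1 - 1) * (\<Prod>k=2..m. fact (n k - 1))) * ((\<Prod>k=2..m. s k ^ (n k - 1)) / q ^ N)"
  proof -
    have "Gamma (\<Sum>k=1..m. real (n k)) = fact (N - 1)"
      using Gamma_nat[OF \<open>1 \<le> N\<close>] by (simp add: N_def)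
    moreover have "(\<Prod>k=1..m. Gamma (real (n k))) = fact (n 1 - 1) * (\<Prod>k=2..m. fact (n k - 1))"
      using n1 n2 unfolding split by (simp add: Gamma_nat)
    ultimately show ?thesis
      using s by (simp add: inv_dirichlet_density_def N_def q_def)
  qed
  then have dens_nonneg: "0 \<le> inv_dirichlet_density m n s"
    using s q by (auto intro!: mult_nonneg_nonneg divide_nonneg_nonneg prod_nonneg)
  have "ennreal (erlang_density (n 1 - 1) 1 x) * (\<Prod>k\<in>{2..m}. ennreal (erlang_density (n k - 1) x (s k)))
      = ennreal (inv_dirichlet_density m n s) * ennreal (erlang_density (N - 1) q x)" for x
  proof (cases "0 \<le> x")
    case True
    have "(\<Prod>k\<in>{2..m}. erlang_density (n k - 1) x (s k))
       = (\<Prod>k\<in>{2..m}. x ^ n k * s k ^ (n k - 1) / fact (n k - 1) * exp (- x * s k))"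
    proof (rule prod.cong)
      fix k assume k: "k \<in> {2..m}"
      \<comment> \<open>The rate occurs in \<open>erlang_density (n k - 1)\<close> with exponent
        \<open>Suc (n k - 1)\<close>; since \<open>n k\<close> is positive, this is exactly
        \<open>n k\<close>.\<close>
      have "Suc (n k - 1) = n k"
        using n2[OF k] by simp
      then show "erlang_density (n k - 1) x (s k) = x ^ n k * s k ^ (n k - 1) / fact (n k - 1) * exp (- x * s k)"
        using s[OF k] by (simp only: erlang_density_def) simp
    qed simp
    also have "\<dots> = x ^ (\<Sum>k=2..m. n k) * (\<Prod>k=2..m. s k ^ (n k - 1)) / (\<Prod>k=2..m. fact (n k - 1))
        * exp (- x * (\<Sum>k=2..m. s k))"
      by (simp add: prod.distrib prod_dividef power_sum sum_distrib_left sum_negf flip: exp_sum)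
    finally have "erlang_density (n 1 - 1) 1 x * (\<Prod>k\<in>{2..m}. erlang_density (n k - 1) x (s k))
      = x ^ (n 1 - 1) * x ^ (\<Sum>k=2..m. n k) * (exp (- x) * exp (- x * (\<Sum>k=2..m. s k)))
         * (\<Prod>k=2..m. s k ^ (n k - 1)) / (fact (n 1 - 1) * (\<Prod>k=2..m. fact (n k - 1)))"
      using True by (simp add: erlang_density_def)
    also have "x ^ (n 1 - 1) * x ^ (\<Sum>k=2..m. n k) = x ^ (N - 1)"
      using n1 by (simp add: N_eq flip: power_add)
    also have "exp (- x) * exp (- x * (\<Sum>k=2..m. s k)) = exp (- q * x)"
      by (simp add: q_def algebra_simps flip: exp_add)
    also have "x ^ (N - 1) * exp (- q * x)
         * (\<Prod>k=2..m. s k ^ (n k - 1)) / (fact (n 1 - 1) * (\<Prod>k=2..m. fact (n k - 1)))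
       = inv_dirichlet_density m n s * erlang_density (N - 1) q x"
      using True q \<open>1 \<le> N\<close> by (simp add: dens erlang_density_def Suc_diff_le flip: power_Suc)
    finally have "erlang_density (n 1 - 1) 1 x * (\<Prod>k\<in>{2..m}. erlang_density (n k - 1) x (s k))
       = inv_dirichlet_density m n s * erlang_density (N - 1) q x" .
    then show ?thesis
      using True dens_nonneg q by (simp add: prod_ennreal prod_nonneg flip: ennreal_mult)
  qed (simp add: erlang_density_def)
  then show ?thesis
    using q by (simp add: nn_integral_cmult nn_integral_erlang_density_UNIV)
qed

text \<open>The event is a box. With the mixture form of the density and the integrals exchanged,
  the inner integral over the box factors into one-dimensional Erlang tails with rate
  \<open>x\<close>.\<close>

lemma inv_dirichlet_prob_greaterThan:
  assumes m: "2 \<le> m" and n: "\<And>j. j \<in> {1..m} \<Longrightarrow> 1 \<le> n j"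
    and c: "\<And>l. l \<in> {2..m} \<Longrightarrow> 0 \<le> c l"
    and X: "inv_dirichlet_distributed M X m n"
  shows "emeasure M {\<omega>\<in>space M. \<forall>l\<in>{2..m}. X l \<omega> > c l}
    = (\<integral>\<^sup>+x. ennreal (erlang_density (n 1 - 1) 1 x)
        * (\<Prod>l\<in>{2..m}. ennreal (poisson_cdf (n l - 1) (c l * x))) \<partial>lborel)"
proof -
  let ?P = "PiM {2..m} (\<lambda>_. lborel) :: (nat \<Rightarrow> real) measure"
  interpret product_sigma_finite "\<lambda>_::nat. lborel :: real measure"
    by standard
  interpret P: finite_product_sigma_finite "\<lambda>_::nat. lborel :: real measure" "{2..m}"
    by standard simp
  interpret pair_sigma_finite lborel ?P
    by standard
  let ?S = "\<Pi>\<^sub>E l\<in>{2..m}. {c l<..}"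
  \<comment> \<open>The indicator of the box is distributed over the factors, so that the integrand
    is a product of functions of single coordinates.\<close>
  let ?f = "\<lambda>x s. ennreal (erlang_density (n 1 - 1) 1 x)
        * (\<Prod>k\<in>{2..m}. ennreal (erlang_density (n k - 1) x (s k)) * indicator {c k<..} (s k))"
  have "{\<omega>\<in>space M. \<forall>l\<in>{2..m}. X l \<omega> > c l} = (\<lambda>\<omega>. \<lambda>k\<in>{2..m}. X k \<omega>) -` ?S \<inter> space M"
    by (auto simp: PiE_iff)
  also have "emeasure M \<dots> = (\<integral>\<^sup>+s. ennreal (inv_dirichlet_density m n s) * indicator ?S s \<partial>?P)"
    using X unfolding inv_dirichlet_distributed_def
    by (rule distributed_emeasure) (auto intro!: sets_PiM_I_finite)
  also have "\<dots> = (\<integral>\<^sup>+s. (\<integral>\<^sup>+x. ?f x s \<partial>lborel) \<partial>?P)"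
  proof (rule nn_integral_cong)
    fix s :: "nat \<Rightarrow> real" assume "s \<in> space ?P"
    then have ext: "s \<in> extensional {2..m}"
      by (auto simp: space_PiM PiE_iff)
    show "ennreal (inv_dirichlet_density m n s) * indicator ?S s = (\<integral>\<^sup>+x. ?f x s \<partial>lborel)"
    proof (cases "s \<in> ?S")
      case True
      then have gt: "c k < s k" if "k \<in> {2..m}" for k
        using that by auto
      then have "0 \<le> s k" if "k \<in> {2..m}" for k
        using c that by (meson less_eq_real_def order_le_less_trans)
      then have "ennreal (inv_dirichlet_density m n s) = (\<integral>\<^sup>+x. ennreal (erlang_density (n 1 - 1) 1 x)
        * (\<Prod>k\<in>{2..m}. ennreal (erlang_density (n k - 1) x (s k))) \<partial>lborel)"
        by (intro inv_dirichlet_density_mixture m n)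
      then show ?thesis
        using True gt by simp
    next
      case False
      \<comment> \<open>Points of the product space are extensional, so \<open>s\<close> can miss
        the box only by violating an inequality at some index, and the factor at that index
        vanishes.\<close>
      then obtain k where k: "k \<in> {2..m}" "\<not> c k < s k"
        using ext by (auto simp: PiE_iff)
      then have "(\<Prod>k\<in>{2..m}. ennreal (erlang_density (n k - 1) x (s k)) * indicator {c k<..} (s k)) = 0" for x
        by (intro prod_zero) (auto intro!: bexI[of _ k])
      with False show ?thesis by (simp only:) simp
    qed
  qed
  \<comment> \<open>The integrand is nonnegative, so the exchange requires only joint measurability,
    with \<open>x\<close> entering also as a rate.\<close>
  also have "\<dots> = (\<integral>\<^sup>+x. (\<integral>\<^sup>+s. ?f x s \<partial>?P) \<partial>lborel)"
    by (rule Fubini') (simp add: erlang_density_def case_prod_beta, measurable)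
  also have "\<dots> = (\<integral>\<^sup>+x. ennreal (erlang_density (n 1 - 1) 1 x)
        * (\<Prod>l\<in>{2..m}. ennreal (poisson_cdf (n l - 1) (c l * x))) \<partial>lborel)"
  proof (rule nn_integral_cong_AE)
    \<comment> \<open>The point 0 has to be discarded: an Erlang density with rate 0 is identically
      0, whereas \<open>poisson_cdf\<close> at 0 equals 1.\<close>
    have "AE x in lborel. x \<noteq> (0::real)"
      by (rule AE_lborel_singleton)
    then show "AE x in lborel. (\<integral>\<^sup>+s. ?f x s \<partial>?P) = ennreal (erlang_density (n 1 - 1) 1 x)
        * (\<Prod>l\<in>{2..m}. ennreal (poisson_cdf (n l - 1) (c l * x)))"
    proof eventually_elim
      fix x :: real assume "x \<noteq> 0"
      show "(\<integral>\<^sup>+s. ?f x s \<partial>?P) = ennreal (erlang_density (n 1 - 1) 1 x)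
        * (\<Prod>l\<in>{2..m}. ennreal (poisson_cdf (n l - 1) (c l * x)))"
      proof (cases "0 < x")
        case True
        have "(\<integral>\<^sup>+s. ?f x s \<partial>?P) = ennreal (erlang_density (n 1 - 1) 1 x)
          * (\<integral>\<^sup>+s. (\<Prod>k\<in>{2..m}. ennreal (erlang_density (n k - 1) x (s k)) * indicator {c k<..} (s k)) \<partial>?P)"
          by (rule nn_integral_cmult) measurable
        also have "(\<integral>\<^sup>+s. (\<Prod>k\<in>{2..m}. ennreal (erlang_density (n k - 1) x (s k)) * indicator {c k<..} (s k)) \<partial>?P)
          = (\<Prod>k\<in>{2..m}. \<integral>\<^sup>+y. ennreal (erlang_density (n k - 1) x y) * indicator {c k<..} y \<partial>lborel)"
          by (rule product_nn_integral_prod) auto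
        also have "\<dots> = (\<Prod>l\<in>{2..m}. ennreal (poisson_cdf (n l - 1) (c l * x)))"
          using True c by (intro prod.cong) (auto simp: nn_integral_erlang_density_greaterThan mult.commute[of _ x])
        finally show ?thesis .
      qed (use \<open>x \<noteq> 0\<close> in \<open>simp add: erlang_density_def\<close>)
    qed
  qed
  finally show ?thesis .
qed

section \<open>Independent gamma variables\<close>

text \<open>The two densities may differ at 0.\<close>

lemma density_gamma_density:
  assumes "1 \<le> j"
  shows "density lborel (\<lambda>x. ennreal (gamma_density (real j) x)) = density lborel (erlang_density (j - 1) 1)"
proof (rule density_cong)
  show "(\<lambda>x. ennreal (gamma_density (real j) x)) \<in> borel_measurable lborel"
    unfolding gamma_density_def by measurable
  have "AE x in lborel. x \<noteq> (0::real)"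
    by (rule AE_lborel_singleton)
  then show "AE x in lborel. ennreal (gamma_density (real j) x) = ennreal (erlang_density (j - 1) 1 x)"
  proof eventually_elim
    fix x :: real assume "x \<noteq> 0"
    have "Gamma (real j) = fact (j - 1)"
      using assms by (cases j) (auto simp: Gamma_fact[symmetric] add_ac)
    moreover have "x powr (real j - 1) = x ^ (j - 1)" if "0 < x"
      using assms that by (simp add: powr_realpow[symmetric] of_nat_diff)
    ultimately show "ennreal (gamma_density (real j) x) = ennreal (erlang_density (j - 1) 1 x)"
      using \<open>x \<noteq> 0\<close> by (auto simp: gamma_density_def erlang_density_def)
  qed
qed simp

text \<open>By independence the joint law is a product measure. Integrating coordinate 1 last
  amounts to conditioning on \<open>G 1 = x\<close>; the event then becomes a box in the other
  coordinates, whose measure is a product of tails.\<close>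

lemma indep_gamma_prob_greater:
  fixes n :: "nat \<Rightarrow> nat" and G :: "nat \<Rightarrow> 'a \<Rightarrow> real"
  assumes m: "2 \<le> m" and n: "\<And>j. j \<in> {1..m} \<Longrightarrow> 1 \<le> n j"
    and c: "\<And>l. l \<in> {2..m} \<Longrightarrow> 0 \<le> c l"
    and "prob_space M" and indep: "prob_space.indep_vars M (\<lambda>_. borel) G {1..m}"
    and G: "\<And>j. j \<in> {1..m} \<Longrightarrow> distributed M lborel (G j) (\<lambda>x. ennreal (gamma_density (real (n j)) x))"
  shows "emeasure M {\<omega>\<in>space M. \<forall>l\<in>{2..m}. G l \<omega> > c l * G 1 \<omega>}
    = (\<integral>\<^sup>+x. ennreal (erlang_density (n 1 - 1) 1 x)
        * (\<Prod>l\<in>{2..m}. ennreal (poisson_cdf (n l - 1) (c l * x))) \<partial>lborel)"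
proof -
  interpret prob_space M by fact
  \<comment> \<open>The Erlang form gives a probability measure at every index, also outside
    \<open>{1..m}\<close>, as the product measure locale demands.\<close>
  define D :: "nat \<Rightarrow> real measure" where "D j = density lborel (erlang_density (n j - 1) 1)" for j
  have sets_D[measurable_cong]: "sets (D j) = sets borel" for j
    by (simp add: D_def)
  have prob_D: "prob_space (D j)" for j
    unfolding D_def by (rule prob_space_erlang_density) simp
  interpret product_sigma_finite D
    using prob_D by (simp add: product_sigma_finite_def prob_space_imp_sigma_finite)
  have rv[measurable]: "G j \<in> borel_measurable M" if "j \<in> {1..m}" for j
    using distributed_measurable[OF G[OF that]] by simp
  have "distr M borel (G j) = D j" if "j \<in> {1..m}" for j
  proof -
    have "distr M borel (G j) = distr M lborel (G j)"
      by (rule distr_cong) auto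
    also have "\<dots> = D j"
      using distributed_distr_eq_density[OF G[OF that]] density_gamma_density[OF n[OF that]]
      by (simp add: D_def)
    finally show ?thesis .
  qed
  then have "PiM {1..m} (\<lambda>j. distr M borel (G j)) = PiM {1..m} D"
    by (intro PiM_cong) auto
  then have joint: "distr M (PiM {1..m} (\<lambda>_. borel)) (\<lambda>\<omega>. \<lambda>j\<in>{1..m}. G j \<omega>) = PiM {1..m} D"
    using indep_vars_iff_distr_eq_PiM'[where I = "{1..m}" and M' = "\<lambda>_. borel" and X = G] indep rv m by simp
  have split: "{1..m} = insert 1 {2..m}"
    using m by auto
  have mem: "1 \<in> {1..m}" "\<And>l. l \<in> {2..m} \<Longrightarrow> l \<in> {1..m}"
    using m by auto
  define S where "S = {g \<in> space (PiM {1..m} (\<lambda>_. borel :: real measure)). \<forall>l\<in>{2..m}. g l > c l * g 1}"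
  have S_sets: "S \<in> sets (PiM {1..m} (\<lambda>_. borel))"
    unfolding S_def using mem by measurable
  moreover have "sets (PiM {1..m} D) = sets (PiM {1..m} (\<lambda>_. borel))"
    by (intro sets_PiM_cong) (simp_all add: sets_D)
  ultimately have S_sets_D[measurable]: "S \<in> sets (PiM {1..m} D)"
    by simp
  have "{\<omega>\<in>space M. \<forall>l\<in>{2..m}. G l \<omega> > c l * G 1 \<omega>} = (\<lambda>\<omega>. \<lambda>j\<in>{1..m}. G j \<omega>) -` S \<inter> space M"
    using mem by (auto simp: S_def space_PiM)
  also have "emeasure M \<dots> = emeasure (PiM {1..m} D) S"
    unfolding joint[symmetric] using S_sets by (subst emeasure_distr) auto
  also have "\<dots> = (\<integral>\<^sup>+g. indicator S g \<partial>PiM (insert 1 {2..m}) D)"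
    using S_sets_D unfolding split by simp
  \<comment> \<open>Coordinate 1 is split off as the outer integral, so that the threshold
    \<open>c l * x\<close> is constant in the inner one.\<close>
  also have "\<dots> = (\<integral>\<^sup>+x. (\<integral>\<^sup>+g. indicator S (g(1 := x)) \<partial>PiM {2..m} D) \<partial>D 1)"
    using S_sets_D unfolding split by (intro product_nn_integral_insert_rev) auto
  also have "\<dots> = (\<integral>\<^sup>+x. (\<Prod>l\<in>{2..m}. emeasure (D l) {c l * x<..}) \<partial>D 1)"
  proof (rule nn_integral_cong)
    fix x :: real
    have "(\<integral>\<^sup>+g. indicator S (g(1 := x)) \<partial>PiM {2..m} D)
       = (\<integral>\<^sup>+g. (\<Prod>l\<in>{2..m}. indicator {c l * x<..} (g l)) \<partial>PiM {2..m} D)"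
    proof (rule nn_integral_cong)
      fix g assume "g \<in> space (PiM {2..m} D)"
      then have "g(1 := x) \<in> space (PiM {1..m} (\<lambda>_. borel :: real measure))"
        using m by (auto simp: space_PiM PiE_iff extensional_def)
      then have *: "g(1 := x) \<in> S \<longleftrightarrow> (\<forall>l\<in>{2..m}. g l > c l * x)"
        by (auto simp: S_def)
      show "indicator S (g(1 := x)) = (\<Prod>l\<in>{2..m}. indicator {c l * x<..} (g l) :: ennreal)"
      proof (cases "g(1 := x) \<in> S")
        case True
        then show ?thesis using * by simp
      next
        case False
        then have "(\<Prod>l\<in>{2..m}. indicator {c l * x<..} (g l) :: ennreal) = 0"
          using * by (intro prod_zero) (auto simp: indicator_def)
        with False show ?thesis by simp
      qed
    qed
    also have "\<dots> = (\<Prod>l\<in>{2..m}. \<integral>\<^sup>+y. indicator {c l * x<..} y \<partial>D l)"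
      by (rule product_nn_integral_prod) auto
    finally show "(\<integral>\<^sup>+g. indicator S (g(1 := x)) \<partial>PiM {2..m} D) = (\<Prod>l\<in>{2..m}. emeasure (D l) {c l * x<..})"
      by (simp add: sets_D)
  qed
  also have "\<dots> = (\<integral>\<^sup>+x. ennreal (erlang_density (n 1 - 1) 1 x)
        * (\<Prod>l\<in>{2..m}. emeasure (D l) {c l * x<..}) \<partial>lborel)"
    unfolding D_def[of 1]
  proof (rule nn_integral_density)
    show "(\<lambda>x. \<Prod>l\<in>{2..m}. emeasure (D l) {c l * x<..}) \<in> borel_measurable lborel"
    proof (rule borel_measurable_prod_ennreal)
      fix l
      \<comment> \<open>Measurability in \<open>x\<close> follows by viewing the half-line above
        \<open>c l * x\<close> as the section at \<open>x\<close> of a measurable set of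
        pairs.\<close>
      have "(\<lambda>x. emeasure (D l) (Pair x -` {p \<in> space (borel \<Otimes>\<^sub>M D l). c l * fst p < snd p}))
          \<in> borel_measurable borel"
        by (rule sigma_finite_measure.measurable_emeasure_Pair[OF prob_space_imp_sigma_finite[OF prob_D]]) measurable
      moreover have "Pair x -` {p \<in> space (borel \<Otimes>\<^sub>M D l). c l * fst p < snd p} = {c l * x<..}" for x
        by (auto simp: space_pair_measure D_def)
      ultimately show "(\<lambda>x. emeasure (D l) {c l * x<..}) \<in> borel_measurable lborel"
        by simp
    qed
  qed simp
  also have "\<dots> = (\<integral>\<^sup>+x. ennreal (erlang_density (n 1 - 1) 1 x)
        * (\<Prod>l\<in>{2..m}. ennreal (poisson_cdf (n l - 1) (c l * x))) \<partial>lborel)"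
  proof (rule nn_integral_cong)
    fix x :: real
    have "emeasure (D l) {c l * x<..} = ennreal (poisson_cdf (n l - 1) (c l * x))"
      if "0 \<le> x" "l \<in> {2..m}" for l
      using nn_integral_erlang_density_greaterThan[of 1 "c l * x" "n l - 1"] that c
      by (simp add: D_def emeasure_density)
    then show "ennreal (erlang_density (n 1 - 1) 1 x) * (\<Prod>l\<in>{2..m}. emeasure (D l) {c l * x<..})
      = ennreal (erlang_density (n 1 - 1) 1 x) * (\<Prod>l\<in>{2..m}. ennreal (poisson_cdf (n l - 1) (c l * x)))"
      by (cases "0 \<le> x") (simp_all add: erlang_density_def)
  qed
  finally show ?thesis .
qed

section \<open>Comparison of the three probabilities\<close>

theorem theorem16:
  fixes m :: nat and n :: "nat \<Rightarrow> nat"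
    and MA :: "'a measure" and A :: "nat \<Rightarrow> 'a \<Rightarrow> nat"
    and MX :: "'b measure" and X :: "nat \<Rightarrow> 'b \<Rightarrow> real"
    and MG :: "'c measure" and G :: "nat \<Rightarrow> 'c \<Rightarrow> real"
  assumes "m \<ge> 2"
    and "\<And>j. j \<in> {1..m} \<Longrightarrow> n j \<ge> 1"
    and "prob_space MA"
    and "neg_multinomial_distributed MA A m (n 1)
           (\<lambda>l. real (n l) / real (\<Sum>j=1..m. n j))"
  shows
    "(prob_space MX \<and> inv_dirichlet_distributed MX X m n \<longrightarrow>
        \<P>(\<omega> in MA. \<forall>l\<in>{2..m}. A l \<omega> \<le> n l - 1)
          = \<P>(\<omega> in MX. \<forall>l\<in>{2..m}. X l \<omega> > real (n l) / real (n 1)))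
     \<and>
     (prob_space MG \<and> prob_space.indep_vars MG (\<lambda>_. borel) G {1..m} \<and>
      (\<forall>j\<in>{1..m}. distributed MG lborel (G j) (\<lambda>x. ennreal (gamma_density (real (n j)) x))) \<longrightarrow>
        \<P>(\<omega> in MA. \<forall>l\<in>{2..m}. A l \<omega> \<le> n l - 1)
          = \<P>(\<omega> in MG. \<forall>l\<in>{2..m}. G l \<omega> / real (n l) > G 1 \<omega> / real (n 1)))"
proof -
  define N where "N = (\<Sum>j=1..m. n j)"
  define c where "c l = real (n l) / real (n 1)" for l
  have n1: "1 \<le> n 1"
    using assms(1,2) by auto
  have split: "{1..m} = insert 1 {2..m}"
    using assms(1) by auto
  have N: "real N = real (n 1) + (\<Sum>l=2..m. real (n l))" "0 < N"
    using n1 unfolding N_def split by simp_all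
  have c: "0 \<le> c l" for l
    by (simp add: c_def)
  \<comment> \<open>With \<open>c l = n l / n 1\<close> the normaliser \<open>q\<close> is
    \<open>N / n 1\<close>, which turns \<open>c l / q\<close> into the prescribed
    \<open>n l / N\<close> and \<open>1 / q\<close> into the leftover probability
    \<open>n 1 / N\<close>.\<close>
  have q: "1 + (\<Sum>l=2..m. c l) = real N / real (n 1)"
    using n1 N by (simp add: c_def field_simps flip: sum_divide_distrib)
  have p: "c l / (real N / real (n 1)) = real (n l) / real N" for l
    using n1 by (simp add: c_def)
  have p1: "1 - (\<Sum>l=2..m. real (n l) / real N) = real (n 1) / real N"
    using N by (simp add: field_simps flip: sum_divide_distrib)
  let ?I = "\<integral>\<^sup>+x. ennreal (erlang_density (n 1 - 1) 1 x)
        * (\<Prod>l\<in>{2..m}. ennreal (poisson_cdf (n l - 1) (c l * x))) \<partial>lborel"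
  let ?\<pi> = "\<P>(\<omega> in MA. \<forall>l\<in>{2..m}. A l \<omega> \<le> n l - 1)"
  \<comment> \<open>The expansion is used with \<open>r = n 1 - 1\<close>; as \<open>n 1\<close> is
    positive, the shifted factorials and the exponent \<open>Suc (n 1 - 1)\<close> agree with those
    of the mass function with parameter \<open>n 1\<close>.\<close>
  have mass: "neg_multinomial_mass m (n 1) (\<lambda>l. real (n l) / real N) k
     = fact (n 1 - 1 + (\<Sum>l=2..m. k l)) / (fact (n 1 - 1) * (\<Prod>l=2..m. fact (k l)))
         * (1 / (real N / real (n 1))) ^ Suc (n 1 - 1) * (\<Prod>l=2..m. (c l / (real N / real (n 1))) ^ k l)" for k
    using n1 unfolding neg_multinomial_mass_def p p1 by simp
  have "?I = ennreal (\<Sum>k\<in>(\<Pi>\<^sub>E l\<in>{2..m}. {..n l - 1}).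
      neg_multinomial_mass m (n 1) (\<lambda>l. real (n l) / real N) k)"
    unfolding mass
    using nn_integral_erlang_prod_poisson_cdf[of "{2..m}" c "n 1 - 1" "\<lambda>l. n l - 1"] c by (simp only: q finite_atLeastAtMost)
  also have "\<dots> = ennreal ?\<pi>"
    using neg_multinomial_prob_atMost[OF assms(3,4), of "\<lambda>l. n l - 1"] by (simp only: N_def)
  finally have I: "?I = ennreal ?\<pi>" .
  show ?thesis
  proof (intro conjI impI)
    assume "prob_space MX \<and> inv_dirichlet_distributed MX X m n"
    then interpret MX: prob_space MX by simp
    have "emeasure MX {\<omega>\<in>space MX. \<forall>l\<in>{2..m}. X l \<omega> > c l} = ?I"
      using \<open>_ \<and> _\<close> assms(1,2) c by (intro inv_dirichlet_prob_greaterThan) auto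
    then show "?\<pi> = \<P>(\<omega> in MX. \<forall>l\<in>{2..m}. X l \<omega> > real (n l) / real (n 1))"
      unfolding I MX.emeasure_eq_measure by (simp add: c_def)
  next
    assume G: "prob_space MG \<and> prob_space.indep_vars MG (\<lambda>_. borel) G {1..m} \<and>
      (\<forall>j\<in>{1..m}. distributed MG lborel (G j) (\<lambda>x. ennreal (gamma_density (real (n j)) x)))"
    then interpret MG: prob_space MG by simp
    have "G l \<omega> / real (n l) > G 1 \<omega> / real (n 1) \<longleftrightarrow> G l \<omega> > c l * G 1 \<omega>" if "l \<in> {2..m}" for l \<omega>
      using n1 assms(2)[of l] that by (simp add: c_def field_simps)
    then have "{\<omega>\<in>space MG. \<forall>l\<in>{2..m}. G l \<omega> / real (n l) > G 1 \<omega> / real (n 1)}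
       = {\<omega>\<in>space MG. \<forall>l\<in>{2..m}. G l \<omega> > c l * G 1 \<omega>}"
      by auto
    moreover have "emeasure MG {\<omega>\<in>space MG. \<forall>l\<in>{2..m}. G l \<omega> > c l * G 1 \<omega>} = ?I"
      using G assms(1,2) c by (intro indep_gamma_prob_greater) auto
    ultimately show "?\<pi> = \<P>(\<omega> in MG. \<forall>l\<in>{2..m}. G l \<omega> / real (n l) > G 1 \<omega> / real (n 1))"
      unfolding I MG.emeasure_eq_measure by simp
  qed
qed

end
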